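(* In the Bayesian $k$-armed bandit problem described in the context, suppose $P_\mu$ is the Bernoulli distribution with mean $\mu$ and the prior $\Gamma$ is $1$-regular with constants $0<c_0<C_0$. Then for $k\ge(30\log T)/c_0$, $$BR_{T,k}(\mathrm{Greedy})\le1+\frac{15T\log T}{kc_0}+\frac{3C_0k}{C_1}\bigl(5+\log(kc_0/5)-\log\log T\bigr),$$ where $C_1=(1-e^{-1})/2$. Furthermore, the Bayesian regret of SS-Greedy executed with subsampling size $m=\Theta(\sqrt T)$ is $\tilde O(\sqrt T)$.
   Context: Bayesian $k$-armed bandit: horizon $T$, arms $[k]$, $P_\mu$ reward distribution of mean $\mu\in[0,1]$; prior $\Gamma$ on $[0,1]$ with density; means i.i.d. $\sim\Gamma$; pulling arm $i$ at time $t$ gives $Y_{it}\sim P_{\mu_i}$ independently, only the pulled reward observed. $R_T(\pi\mid\bm\mu)=T\max_i\mu_i-\sum_t\mathbb{E}[\mu_{a_t}\mid\pi]$, $BR_{T,k}(\pi)=\mathbb{E}[R_T(\pi\mid\bm\mu)]$. $1$-regular: $c_0\epsilon\le\mathbb{P}_\Gamma(\mu>1-\epsilon)\le\mathbb{P}_\Gamma(\mu\ge1-\epsilon)\le C_0\epsilon$ for all $\epsilon\in(0,1]$. Greedy: pull each arm once ($a_t=t$ for $t\le k$), then pull the arm with the largest empirical mean reward. SS-Greedy with parameter $m$: draw $m$ arms uniformly without replacement from $[k]$ and run Greedy on them. $\tilde O$ hides polylogarithmic factors in $T$ and constants. *)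

theory Defs
  imports "HOL-Probability.Probability"
begin

text \<open>Reward tables: Y (i,t) is the Bernoulli reward of arm i at time t (times 0..T-1).
  Only the reward of the pulled arm at time t is ever read by the algorithms.\<close>

definition reward_pmf :: "nat \<Rightarrow> nat \<Rightarrow> (nat \<Rightarrow> real) \<Rightarrow> (nat \<times> nat \<Rightarrow> bool) pmf" where
  "reward_pmf k T \<mu> = Pi_pmf ({..<k} \<times> {..<T}) False (\<lambda>(i,t). bernoulli_pmf (\<mu> i))"

definition emp_mean :: "(nat \<times> nat \<Rightarrow> bool) \<Rightarrow> nat list \<Rightarrow> nat \<Rightarrow> real" where
  "emp_mean Y hist i =
     (let ts = {s. s < length hist \<and> hist ! s = i}
      in (\<Sum>s\<in>ts. if Y (i, s) then 1 else 0) / real (card ts))"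

definition greedy_next :: "nat set \<Rightarrow> (nat \<times> nat \<Rightarrow> bool) \<Rightarrow> nat list \<Rightarrow> nat" where
  "greedy_next S Y h =
     (if length h < card S then sorted_list_of_set S ! length h
      else (LEAST i. i \<in> S \<and> (\<forall>j\<in>S. emp_mean Y h j \<le> emp_mean Y h i)))"

fun greedy_hist :: "nat set \<Rightarrow> (nat \<times> nat \<Rightarrow> bool) \<Rightarrow> nat \<Rightarrow> nat list" where
  "greedy_hist S Y 0 = []"
| "greedy_hist S Y (Suc t) = (let h = greedy_hist S Y t in h @ [greedy_next S Y h])"

definition greedy_action :: "nat set \<Rightarrow> (nat \<times> nat \<Rightarrow> bool) \<Rightarrow> nat \<Rightarrow> nat" where
  "greedy_action S Y t = greedy_next S Y (greedy_hist S Y t)"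

definition greedy_reward :: "nat set \<Rightarrow> nat \<Rightarrow> nat \<Rightarrow> (nat \<Rightarrow> real) \<Rightarrow> real" where
  "greedy_reward S k T \<mu> =
     measure_pmf.expectation (reward_pmf k T \<mu>) (\<lambda>Y. \<Sum>t<T. \<mu> (greedy_action S Y t))"

definition regret_greedy :: "nat \<Rightarrow> nat \<Rightarrow> (nat \<Rightarrow> real) \<Rightarrow> real" where
  "regret_greedy k T \<mu> = real T * Max (\<mu> ` {..<k}) - greedy_reward {..<k} k T \<mu>"

definition subsets_pmf :: "nat \<Rightarrow> nat \<Rightarrow> nat set pmf" where
  "subsets_pmf m k = pmf_of_set {S. S \<subseteq> {..<k} \<and> card S = m}"

definition regret_ss_greedy :: "nat \<Rightarrow> nat \<Rightarrow> nat \<Rightarrow> (nat \<Rightarrow> real) \<Rightarrow> real" where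
  "regret_ss_greedy m k T \<mu> = real T * Max (\<mu> ` {..<k})
     - measure_pmf.expectation (subsets_pmf m k) (\<lambda>S. greedy_reward S k T \<mu>)"

definition is_prior_density :: "(real \<Rightarrow> real) \<Rightarrow> bool" where
  "is_prior_density g \<longleftrightarrow> g \<in> borel_measurable borel \<and> (\<forall>x. 0 \<le> g x)
     \<and> (\<forall>x. x \<notin> {0..1} \<longrightarrow> g x = 0) \<and> (\<integral>\<^sup>+x. ennreal (g x) \<partial>lborel) = 1"

definition prior :: "(real \<Rightarrow> real) \<Rightarrow> real measure" where
  "prior g = density lborel (\<lambda>x. ennreal (g x))"

definition one_regular :: "(real \<Rightarrow> real) \<Rightarrow> real \<Rightarrow> real \<Rightarrow> bool" where
  "one_regular g c0 C0 \<longleftrightarrow> (\<forall>\<epsilon>. 0 < \<epsilon> \<and> \<epsilon> \<le> 1 \<longrightarrow>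
      c0 * \<epsilon> \<le> measure (prior g) {1 - \<epsilon><..}
    \<and> measure (prior g) {1 - \<epsilon><..} \<le> measure (prior g) {1 - \<epsilon>..}
    \<and> measure (prior g) {1 - \<epsilon>..} \<le> C0 * \<epsilon>)"

definition means_measure :: "(real \<Rightarrow> real) \<Rightarrow> nat \<Rightarrow> (nat \<Rightarrow> real) measure" where
  "means_measure g k = PiM {..<k} (\<lambda>_. prior g)"

definition BR_greedy :: "(real \<Rightarrow> real) \<Rightarrow> nat \<Rightarrow> nat \<Rightarrow> real" where
  "BR_greedy g T k = (\<integral>\<mu>. regret_greedy k T \<mu> \<partial>means_measure g k)"

definition BR_ss_greedy :: "(real \<Rightarrow> real) \<Rightarrow> nat \<Rightarrow> nat \<Rightarrow> nat \<Rightarrow> real" where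
  "BR_ss_greedy g m T k = (\<integral>\<mu>. regret_ss_greedy m k T \<mu> \<partial>means_measure g k)"

end

theory Submission
  imports Defs "HOL-Real_Asymp.Real_Asymp"
begin

text \<open>Put \<open>\<delta> = 5 ln T / (k c0)\<close> and compare empirical means with the threshold \<open>1 - 2\<delta>\<close>. As long as
  some arm of mean above \<open>1 - \<delta>\<close> has never fallen below the threshold, Greedy only pulls arms whose
  empirical mean is above it, which an arm of gap \<open>\<Delta> \<ge> 3\<delta>\<close> survives for at most \<open>19 / \<Delta>\<close> pulls in
  expectation; arms of smaller gap cost at most \<open>3\<delta>T\<close> in total. Each good arm stays above the
  threshold with probability at least 1/5, so the probability that all of them fall below it, averaged
  over the prior, is at most \<open>(1 - c0 \<delta> / 5)^k \<le> 1 / T\<close>. Both estimates come from nonnegative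
  supermartingales run in the time of the bandit process itself: since only the pulled arm changes,
  the product over the good arms of their crossing bounds is again a supermartingale, and the rewards
  never have to be re-indexed by pull counts.\<close>

section \<open>Resampling one reward\<close>

text \<open>Coordinates of a product law are independent, so redrawing one of them from its own
  marginal leaves the law unchanged.\<close>

lemma Pi_pmf_resample:
  assumes "finite A" "x \<in> A"
  shows "Pi_pmf A d p = do {Y \<leftarrow> Pi_pmf A d p; b \<leftarrow> p x; return_pmf (Y(x := b))}"
proof -
  have *: "Pi_pmf A d p = do {b \<leftarrow> p x; Y \<leftarrow> Pi_pmf (A - {x}) d p; return_pmf (Y(x := b))}"
    using Pi_pmf_insert'[of "A - {x}" x d p] assms by (simp add: insert_absorb)
  have "do {Y \<leftarrow> Pi_pmf A d p; b \<leftarrow> p x; return_pmf (Y(x := b))} =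
      do {Y \<leftarrow> Pi_pmf (A - {x}) d p; b \<leftarrow> p x; return_pmf (Y(x := b))}"
    by (subst *) (simp add: bind_assoc_pmf bind_return_pmf)
  also have "\<dots> = do {b \<leftarrow> p x; Y \<leftarrow> Pi_pmf (A - {x}) d p; return_pmf (Y(x := b))}"
    by (rule bind_commute_pmf)
  finally show ?thesis using * by simp
qed

lemma finite_set_reward_pmf: "finite (set_pmf (reward_pmf k T \<mu>))"
  unfolding reward_pmf_def
  by (rule finite_subset[OF set_Pi_pmf_subset']) (auto intro!: finite_PiE_dflt)

lemma integrable_reward_pmf [simp]:
  fixes f :: "_ \<Rightarrow> real"
  shows "integrable (measure_pmf (reward_pmf k T \<mu>)) f"
  by (rule integrable_measure_pmf_finite[OF finite_set_reward_pmf])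

lemma expectation_resample:
  fixes h :: "(nat \<times> nat \<Rightarrow> bool) \<Rightarrow> real"
  assumes "i < k" "t < T" "0 \<le> \<mu> i" "\<mu> i \<le> 1"
  shows "measure_pmf.expectation (reward_pmf k T \<mu>) h =
    measure_pmf.expectation (reward_pmf k T \<mu>)
      (\<lambda>Y. \<mu> i * h (Y((i, t) := True)) + (1 - \<mu> i) * h (Y((i, t) := False)))"
proof -
  let ?M = "reward_pmf k T \<mu>"
  have fin: "finite (set_pmf ?M)" by (rule finite_set_reward_pmf)
  have "?M = do {Y \<leftarrow> ?M; b \<leftarrow> bernoulli_pmf (\<mu> i); return_pmf (Y((i, t) := b))}"
    using Pi_pmf_resample[of "{..<k} \<times> {..<T}" "(i, t)" False "\<lambda>(i, t). bernoulli_pmf (\<mu> i)"] assms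
    by (simp add: reward_pmf_def)
  then have "measure_pmf.expectation ?M h = measure_pmf.expectation
      (do {Y \<leftarrow> ?M; map_pmf (\<lambda>b. Y((i, t) := b)) (bernoulli_pmf (\<mu> i))}) h"
    by (simp add: map_pmf_def)
  also have "\<dots> = (\<Sum>Y\<in>set_pmf ?M. pmf ?M Y *\<^sub>R
      (\<mu> i * h (Y((i, t) := True)) + (1 - \<mu> i) * h (Y((i, t) := False))))"
    using assms fin by (subst pmf_expectation_bind[of "set_pmf ?M"]) (auto simp: mult.commute)
  also have "\<dots> = measure_pmf.expectation ?M
      (\<lambda>Y. \<mu> i * h (Y((i, t) := True)) + (1 - \<mu> i) * h (Y((i, t) := False)))"
    using fin by (subst integral_measure_pmf[of "set_pmf ?M"]) auto
  finally show ?thesis .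
qed

text \<open>One-step supermartingale inequality without filtrations or conditional expectations. The
  choice \<open>a\<close> does not look at rewards of time \<open>t\<close>, so the reward it is
  about to receive is a fresh Bernoulli variable.\<close>

lemma expectation_step:
  fixes F G :: "(nat \<times> nat \<Rightarrow> bool) \<Rightarrow> real" and a :: "(nat \<times> nat \<Rightarrow> bool) \<Rightarrow> nat"
  assumes mu: "\<And>i. i < k \<Longrightarrow> 0 \<le> \<mu> i \<and> \<mu> i \<le> 1" and t: "t < T"
    and a: "\<And>Y. a Y < k" "\<And>Y i b. a (Y((i, t) := b)) = a Y"
    and step: "\<And>Y. \<mu> (a Y) * F (Y((a Y, t) := True)) + (1 - \<mu> (a Y)) * F (Y((a Y, t) := False)) \<le> G Y"
  shows "measure_pmf.expectation (reward_pmf k T \<mu>) F \<le> measure_pmf.expectation (reward_pmf k T \<mu>) G"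
proof -
  let ?E = "measure_pmf.expectation (reward_pmf k T \<mu>)"
  have split: "?E H = (\<Sum>j<k. ?E (\<lambda>Y. of_bool (a Y = j) * H Y))" for H :: "_ \<Rightarrow> real"
  proof -
    have "H Y = (\<Sum>j<k. of_bool (a Y = j) * H Y)" for Y
      using a(1)[of Y] by (simp add: of_bool_def if_distrib if_distribR sum.delta' cong: if_cong)
    then have "?E H = ?E (\<lambda>Y. \<Sum>j<k. of_bool (a Y = j) * H Y)" by presburger
    also have "\<dots> = (\<Sum>j<k. ?E (\<lambda>Y. of_bool (a Y = j) * H Y))"
      by (rule Bochner_Integration.integral_sum) simp
    finally show ?thesis .
  qed
  \<comment> \<open>On the event \<open>a Y = j\<close> the coordinate to redraw is the fixed
    \<open>(j, t)\<close>, and redrawing it does not change the event.\<close>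
  have "?E (\<lambda>Y. of_bool (a Y = j) * F Y) \<le> ?E (\<lambda>Y. of_bool (a Y = j) * G Y)" if "j < k" for j
  proof (subst expectation_resample[OF that t], goal_cases)
    case 3
    show ?case
    proof (rule integral_mono)
      show "\<mu> j * (of_bool (a (Y((j, t) := True)) = j) * F (Y((j, t) := True))) +
          (1 - \<mu> j) * (of_bool (a (Y((j, t) := False)) = j) * F (Y((j, t) := False)))
          \<le> of_bool (a Y = j) * G Y" for Y
        using step[of Y] by (auto simp: a(2))
    qed auto
  qed (use mu that in auto)
  then show ?thesis by (subst (1 2) split) (rule sum_mono, auto)
qed

section \<open>Non-anticipating policies\<close>

text \<open>Replaces adaptedness to a filtration; phrased through single updates because rewards are
  resampled one at a time.\<close>

definition non_anticipating :: "((nat \<times> nat \<Rightarrow> bool) \<Rightarrow> nat \<Rightarrow> nat) \<Rightarrow> bool" where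
  "non_anticipating act \<longleftrightarrow> (\<forall>Y i s b t. t \<le> s \<longrightarrow> act (Y((i, s) := b)) t = act Y t)"

lemma non_anticipatingD: "non_anticipating act \<Longrightarrow> t \<le> s \<Longrightarrow> act (Y((i, s) := b)) t = act Y t"
  by (auto simp: non_anticipating_def)

definition pulls :: "((nat \<times> nat \<Rightarrow> bool) \<Rightarrow> nat \<Rightarrow> nat) \<Rightarrow> (nat \<times> nat \<Rightarrow> bool) \<Rightarrow> nat \<Rightarrow> nat \<Rightarrow> nat" where
  "pulls act Y i t = (\<Sum>s<t. of_bool (act Y s = i))"

definition fails :: "((nat \<times> nat \<Rightarrow> bool) \<Rightarrow> nat \<Rightarrow> nat) \<Rightarrow> (nat \<times> nat \<Rightarrow> bool) \<Rightarrow> nat \<Rightarrow> nat \<Rightarrow> nat" where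
  "fails act Y i t = (\<Sum>s<t. of_bool (act Y s = i \<and> \<not> Y (i, s)))"

text \<open>Says that the empirical mean has dropped below \<open>1 - \<theta>\<close> at some time
  up to \<open>t\<close>. Cleared denominators make an arm without pulls count as not
  crossed.\<close>

definition crossed :: "real \<Rightarrow> ((nat \<times> nat \<Rightarrow> bool) \<Rightarrow> nat \<Rightarrow> nat) \<Rightarrow> (nat \<times> nat \<Rightarrow> bool) \<Rightarrow> nat \<Rightarrow> nat \<Rightarrow> bool" where
  "crossed \<theta> act Y i t \<longleftrightarrow> (\<exists>s\<le>t. \<theta> * real (pulls act Y i s) < real (fails act Y i s))"

context
  fixes act assumes act: "non_anticipating act"
begin

text \<open>The range reaches \<open>Suc t\<close>, one further than for \<open>fails\<close>: the
  pull at time \<open>t\<close> is decided before any reward of time \<open>t\<close> is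
  read.\<close>

lemma pulls_upd: "s \<le> Suc t \<Longrightarrow> pulls act (Y((j, t) := b)) i s = pulls act Y i s"
  unfolding pulls_def by (intro sum.cong) (auto simp: non_anticipatingD[OF act])

lemma fails_upd: "s \<le> t \<Longrightarrow> fails act (Y((j, t) := b)) i s = fails act Y i s"
  unfolding fails_def by (intro sum.cong) (auto simp: non_anticipatingD[OF act])

lemma fails_upd_Suc:
  "fails act (Y((act Y t, t) := b)) i (Suc t) = fails act Y i t + of_bool (act Y t = i \<and> \<not> b)"
  using fails_upd[of t t Y "act Y t" b i] non_anticipatingD[OF act]
  by (auto simp: fails_def)

lemma pulls_upd_Suc:
  "pulls act (Y((j, t) := b)) i (Suc t) = pulls act Y i t + of_bool (act Y t = i)"
  using pulls_upd[of "Suc t" t] by (simp add: pulls_def)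

lemma crossed_Suc:
  "crossed \<theta> act Y i (Suc t) \<longleftrightarrow> crossed \<theta> act Y i t \<or>
    \<theta> * real (pulls act Y i (Suc t)) < real (fails act Y i (Suc t))"
  unfolding crossed_def by (auto simp: le_Suc_eq)

lemma crossed_upd: "crossed \<theta> act (Y((j, t) := b)) i t = crossed \<theta> act Y i t"
  unfolding crossed_def by (auto simp: pulls_upd fails_upd)

end

section \<open>A bad arm is rarely pulled above the threshold\<close>

text \<open>The left-hand side is the expected factor by which one pull of an arm of gap \<open>\<Delta>\<close> multiplies the
  potential \<open>exp ((2\<delta> n - f) / 3)\<close> after \<open>n\<close> pulls with \<open>f\<close> failures.\<close>

lemma exp_tilt_bound:
  fixes \<Delta> \<delta> :: real
  assumes "0 \<le> \<delta>" "3 * \<delta> \<le> \<Delta>" "\<Delta> \<le> 1"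
  shows "exp (2 * \<delta> / 3) * (1 - \<Delta> + \<Delta> * exp (- (1 / 3))) \<le> 1 - \<Delta> / 19"
proof -
  have D: "0 \<le> \<Delta>" using assms by linarith
  \<comment> \<open>25/18 = 1 + 1/3 + 1/18 is the quadratic Taylor polynomial at 1/3; below, 7/25 =
    1 - 18/25 and 13/225 = 7/25 - 2/9, where 2/9 comes from 3\<delta> \<le> \<Delta>.\<close>
  have "25 / 18 \<le> exp (1 / 3 :: real)"
    using exp_lower_Taylor_quadratic[of "1 / 3 :: real"] by (simp add: power2_eq_square)
  then have "exp (- (1 / 3)) \<le> (18 / 25 :: real)"
    by (simp add: exp_minus field_simps)
  then have "\<Delta> * exp (- (1 / 3)) \<le> \<Delta> * (18 / 25)" using D by (rule mult_left_mono)
  then have "1 - \<Delta> + \<Delta> * exp (- (1 / 3)) \<le> 1 + (- (7 / 25 * \<Delta>))" by simp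
  also have "\<dots> \<le> exp (- (7 / 25 * \<Delta>))" by (rule exp_ge_add_one_self)
  finally have "exp (2 * \<delta> / 3) * (1 - \<Delta> + \<Delta> * exp (- (1 / 3)))
      \<le> exp (2 * \<Delta> / 9) * exp (- (7 / 25 * \<Delta>))"
    using assms by (intro mult_mono) auto
  also have "\<dots> = exp (- (13 / 225 * \<Delta>))" by (simp flip: exp_add)
  also have "\<dots> \<le> 1 / (1 + 13 / 225 * \<Delta>)"
    using exp_ge_add_one_self[of "13 / 225 * \<Delta>"] D
    by (simp add: exp_minus inverse_eq_divide frac_le del: exp_ge_add_one_self)
  \<comment> \<open>Since 13/225 exceeds 1/19 by 22/4275, the linear gain absorbs the quadratic loss
    13/4275.\<close>
  also have "\<dots> \<le> 1 - \<Delta> / 19"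
  proof -
    have "\<Delta> * \<Delta> \<le> \<Delta>" using D assms by (simp add: mult_left_le)
    moreover have "(1 - \<Delta> / 19) * (1 + 13 / 225 * \<Delta>) =
        1 + 22 / 4275 * \<Delta> - 13 / 4275 * (\<Delta> * \<Delta>)"
      by (simp add: field_simps)
    ultimately have "1 \<le> (1 - \<Delta> / 19) * (1 + 13 / 225 * \<Delta>)"
      using D by linarith
    then show ?thesis using D by (simp add: pos_divide_le_eq)
  qed
  finally show ?thesis .
qed

text \<open>The potential \<open>W\<close> starts at 1, stays nonnegative, and in expectation loses
  at least \<open>D / 19\<close> per round, so the total of \<open>D\<close> is at most 19.
  Weighting pulls by the gap makes this constant independent of the arm.\<close>

lemma bad_arm_pulls:
  fixes \<delta> :: real
  assumes act: "non_anticipating act" and range: "\<And>Y t. act Y t < k"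
    and mu: "\<And>i. i < k \<Longrightarrow> 0 \<le> \<mu> i \<and> \<mu> i \<le> 1"
    and \<delta>: "0 \<le> \<delta>" and i: "3 * \<delta> \<le> 1 - \<mu> i" "0 \<le> \<mu> i"
  shows "measure_pmf.expectation (reward_pmf k T \<mu>) (\<lambda>Y. \<Sum>t<T. (1 - \<mu> i) *
      of_bool (act Y t = i \<and> real (fails act Y i t) \<le> 2 * \<delta> * real (pulls act Y i t))) \<le> 19"
proof -
  let ?E = "measure_pmf.expectation (reward_pmf k T \<mu>)"
  define W where "W t Y = exp ((2 * \<delta> * real (pulls act Y i t) - real (fails act Y i t)) / 3)" for t Y
  define D where "D t Y = (1 - \<mu> i) * of_bool (act Y t = i \<and>
      real (fails act Y i t) \<le> 2 * \<delta> * real (pulls act Y i t))" for t Y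
  have W0: "W 0 Y = 1" for Y by (simp add: W_def pulls_def fails_def)
  have step: "?E (W (Suc t)) \<le> ?E (\<lambda>Y. W t Y - D t Y / 19)" if "t < T" for t
  proof (rule expectation_step[OF mu that, where a = "\<lambda>Y. act Y t"])
    fix Y
    let ?j = "act Y t"
    show "\<mu> ?j * W (Suc t) (Y((?j, t) := True)) + (1 - \<mu> ?j) * W (Suc t) (Y((?j, t) := False))
        \<le> W t Y - D t Y / 19"
    proof (cases "?j = i")
      case False
      then show ?thesis
        by (simp add: W_def D_def pulls_upd_Suc[OF act] fails_upd_Suc[OF act] algebra_simps)
    next
      case True
      have "W (Suc t) (Y((i, t) := b)) = W t Y * exp (2 * \<delta> / 3) * (if b then 1 else exp (- (1 / 3)))" for b
        using fails_upd_Suc[OF act, of Y t b i] True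
        by (simp add: W_def pulls_upd_Suc[OF act] add_divide_distrib diff_divide_distrib
            ring_distribs flip: exp_add)
      then have "\<mu> i * W (Suc t) (Y((i, t) := True)) + (1 - \<mu> i) * W (Suc t) (Y((i, t) := False))
          = W t Y * (exp (2 * \<delta> / 3) * (1 - (1 - \<mu> i) + (1 - \<mu> i) * exp (- (1 / 3))))"
        by (simp add: algebra_simps)
      also have "\<dots> \<le> W t Y * (1 - (1 - \<mu> i) / 19)"
        using \<delta> i by (intro mult_left_mono exp_tilt_bound) (auto simp: W_def)
      also have "\<dots> = W t Y - (1 - \<mu> i) * W t Y / 19" by (simp add: field_simps)
      also have "\<dots> \<le> W t Y - D t Y / 19"
      \<comment> \<open>Above the threshold the exponent of \<open>W\<close> is nonnegative, so
        \<open>W\<close> is at least 1 and its relative decrease pays for \<open>D\<close>; below it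
        \<open>D\<close> is 0.\<close>
      proof (cases "real (fails act Y i t) \<le> 2 * \<delta> * real (pulls act Y i t)")
        case True
        then have "1 \<le> W t Y" by (simp add: W_def)
        then have "(1 - \<mu> i) * 1 \<le> (1 - \<mu> i) * W t Y" using i \<delta> by (intro mult_left_mono) auto
        then show ?thesis by (simp add: D_def True \<open>?j = i\<close>)
      next
        case False
        have "0 \<le> (1 - \<mu> i) * W t Y" using i \<delta> by (simp add: W_def)
        then show ?thesis using False by (simp add: D_def)
      qed
      finally show ?thesis by (simp add: True)
    qed
  qed (auto simp: range non_anticipatingD[OF act])
  have "?E (W n) + (\<Sum>t<n. ?E (D t)) / 19 \<le> 1" if "n \<le> T" for n
    using that
  proof (induction n)
    case 0
    then show ?case by (simp add: W0)
  next
    case (Suc n)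
    have "?E (W (Suc n)) \<le> ?E (W n) - ?E (D n) / 19"
      using step[of n] Suc.prems by (simp add: Suc_le_eq)
    then show ?case using Suc by (simp add: add_divide_distrib)
  qed
  from this[of T] have "?E (W T) + (\<Sum>t<T. ?E (D t)) / 19 \<le> 1" by simp
  moreover have "0 \<le> ?E (W T)" by (simp add: W_def)
  ultimately have "(\<Sum>t<T. ?E (D t)) \<le> 19" by linarith
  moreover have "?E (\<lambda>Y. \<Sum>t<T. D t Y) = (\<Sum>t<T. ?E (D t))"
    by (rule Bochner_Integration.integral_sum) simp
  ultimately show ?thesis by (simp add: D_def)
qed

section \<open>A good arm never crosses the threshold with probability at least 1/5\<close>

text \<open>An upper bound for the probability that an arm with failure probability at most \<open>\<delta>\<close>, pulled
  \<open>n\<close> times with \<open>f\<close> failures, ever has more than \<open>2\<delta>n\<close> failures, \<open>c\<close> recording whether this has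
  happened. With \<open>N\<close> the least integer \<open>\<ge> 1/(2\<delta>)\<close>, a single failure is fatal while \<open>n < N\<close>, so
  the first phase is a run of successes; afterwards the bound is the exponential supermartingale.\<close>

definition crossing_bound :: "real \<Rightarrow> nat \<Rightarrow> nat \<Rightarrow> nat \<Rightarrow> bool \<Rightarrow> real" where
  "crossing_bound \<delta> N n f c = (if c then 1
     else if n < N then 1 - (1 - exp (-1)) * (1 - real (N - n) * \<delta>)
     else exp (real f - 2 * \<delta> * real n))"

lemma exp_minus_one_le: "exp (-1) \<le> (2 / 5 :: real)"
  using exp_lower_Taylor_quadratic[of "1 :: real"] by (simp add: exp_minus field_simps)

context
  fixes \<delta> :: real and N :: nat
  assumes \<delta>: "0 < \<delta>" "\<delta> \<le> 1 / 6"
    and N: "1 \<le> 2 * \<delta> * real N" "\<And>n. n < N \<Longrightarrow> 2 * \<delta> * real n < 1"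
begin

text \<open>By minimality 2\<delta>(N - 1) < 1, hence N\<delta> < 1/2 + \<delta>, and \<delta> \<le>
  1/6 gives 2/3.\<close>

lemma N_delta: "real N * \<delta> \<le> 2 / 3"
proof (cases N)
  case (Suc n)
  then show ?thesis using N(2)[of n] \<delta> by (simp add: algebra_simps)
qed simp

lemma N_minus_delta: "real (N - n) * \<delta> \<le> 2 / 3"
  by (rule order_trans[OF mult_right_mono N_delta]) (use \<delta> in auto)

lemma crossing_bound_nonneg: "0 \<le> crossing_bound \<delta> N n f c"
proof -
  have "(1 - exp (-1)) * (1 - real (N - n) * \<delta>) \<le> 1"
    using N_minus_delta[of n] \<delta> by (intro mult_le_one) auto
  then show ?thesis by (simp add: crossing_bound_def del: of_nat_diff)
qed

text \<open>The first N pulls all succeed with probability at least 1 - N\<delta> \<ge> 1/3 by a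
  union bound, and the later phase then survives with probability at least 1 - 1/e \<ge>
  3/5.\<close>

lemma crossing_bound_0: "crossing_bound \<delta> N 0 0 False \<le> 4 / 5"
proof -
  have "(3 / 5) * (1 / 3) \<le> (1 - exp (-1)) * (1 - real N * \<delta>)"
    using exp_minus_one_le N_delta by (intro mult_mono) auto
  moreover have "0 < N" using N(1) by (cases N) auto
  ultimately show ?thesis by (simp add: crossing_bound_def)
qed

lemma crossing_bound_step:
  assumes p: "0 \<le> p" "1 - p \<le> \<delta>" "p \<le> 1" and f: "\<not> c \<Longrightarrow> real f \<le> 2 * \<delta> * real n"
  shows "p * crossing_bound \<delta> N (Suc n) f (c \<or> 2 * \<delta> * real (Suc n) < real f)
     + (1 - p) * crossing_bound \<delta> N (Suc n) (Suc f) (c \<or> 2 * \<delta> * real (Suc n) < real (Suc f))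
     \<le> crossing_bound \<delta> N n f c"
proof -
  let ?V = "crossing_bound \<delta> N"
  \<comment> \<open>Also valid on a crossing: the exponent is then positive, so the exponential
    exceeds the value 1.\<close>
  have after: "?V (Suc n) f' (2 * \<delta> * real (Suc n) < real f') \<le> exp (real f' - 2 * \<delta> * real (Suc n))"
    if "N \<le> Suc n" for f'
    using that by (auto simp: crossing_bound_def)
  consider (c) c | (early) "\<not> c" "n < N" | (late) "\<not> c" "N \<le> n" by linarith
  then show ?thesis
  proof cases
    case c
    then show ?thesis by (simp add: crossing_bound_def)
  next
    case early
    define \<kappa> where "\<kappa> = 1 - exp (-1 :: real)"
    have k: "0 \<le> \<kappa>" by (simp add: \<kappa>_def)
    define x where "x = real (N - Suc n) * \<delta>"
    have x: "x \<le> 2 / 3" "0 \<le> x" using N_minus_delta[of "Suc n"] \<delta> by (auto simp: x_def)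
    have Nn: "real (N - n) * \<delta> = x + \<delta>" using early by (simp add: x_def of_nat_diff algebra_simps)
    \<comment> \<open>Without a crossing, fewer than N pulls leave room for no failure at
      all.\<close>
    have "real f < 1" using f N(2)[of n] early by linarith
    then have f0: "f = 0" by simp
    have nc: "\<not> 2 * \<delta> * real (Suc n) < real f" using \<delta> f0 by (simp add: not_less)
    have A: "?V (Suc n) f (c \<or> 2 * \<delta> * real (Suc n) < real f) \<le> 1 - \<kappa> * (1 - x)"
    proof (cases "Suc n < N")
      case True
      then show ?thesis using early nc by (simp add: crossing_bound_def \<kappa>_def x_def del: of_nat_Suc of_nat_diff)
    next
      \<comment> \<open>This is the change of phase at \<open>Suc n = N\<close>: with no failures
        the exponential is at most 1/e because 2\<delta>N \<ge> 1, and \<open>x\<close> is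
        0.\<close>
      case False
      then have "Suc n = N" using early by simp
      moreover have "exp (- (2 * \<delta> * real N)) \<le> exp (-1)" using N(1) by simp
      ultimately show ?thesis using early nc f0 by (simp add: crossing_bound_def \<kappa>_def x_def del: of_nat_Suc)
    qed
    have B: "?V (Suc n) (Suc f) (c \<or> 2 * \<delta> * real (Suc n) < real (Suc f)) \<le> 1"
    proof (cases "Suc n < N")
      case True
      then show ?thesis using early f0 N(2)[OF True] by (simp add: crossing_bound_def)
    next
      case False
      then show ?thesis using early f0 N(1) by (auto simp: crossing_bound_def)
    qed
    have "p * ?V (Suc n) f (c \<or> 2 * \<delta> * real (Suc n) < real f)
       + (1 - p) * ?V (Suc n) (Suc f) (c \<or> 2 * \<delta> * real (Suc n) < real (Suc f))
       \<le> p * (1 - \<kappa> * (1 - x)) + (1 - p) * 1"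
      using A B p by (intro add_mono mult_left_mono) auto
    also have "\<dots> = 1 - \<kappa> * (p * (1 - x))" by (simp add: algebra_simps)
    also have "\<dots> \<le> 1 - \<kappa> * (1 - (x + \<delta>))"
    proof -
      have "(1 - \<delta>) * (1 - x) \<le> p * (1 - x)" using p x by (intro mult_right_mono) auto
      moreover have "0 \<le> \<delta> * x" using \<delta> x by simp
      ultimately have "1 - (x + \<delta>) \<le> p * (1 - x)" by (simp add: algebra_simps)
      then have "\<kappa> * (1 - (x + \<delta>)) \<le> \<kappa> * (p * (1 - x))" using k by (rule mult_left_mono)
      then show ?thesis by simp
    qed
    also have "\<dots> = ?V n f c" using early Nn by (simp add: crossing_bound_def \<kappa>_def)
    finally show ?thesis .
  next
    case late
    let ?e = "exp (real f - 2 * \<delta> * real n)"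
    have "p * ?V (Suc n) f (c \<or> 2 * \<delta> * real (Suc n) < real f)
       + (1 - p) * ?V (Suc n) (Suc f) (c \<or> 2 * \<delta> * real (Suc n) < real (Suc f))
       \<le> p * exp (real f - 2 * \<delta> * real (Suc n)) + (1 - p) * exp (real (Suc f) - 2 * \<delta> * real (Suc n))"
      using p late after[of f] after[of "Suc f"] by (intro add_mono mult_left_mono) auto
    also have "\<dots> = ?e * (exp (- (2 * \<delta>)) * (1 + (1 - p) * (exp 1 - 1)))"
      by (simp add: algebra_simps flip: exp_add)
    \<comment> \<open>A threshold at twice the failure rate suffices because e - 1 \<le> 2, so the
      mean growth factor is at most 1 + 2\<delta>.\<close>
    also have "\<dots> \<le> ?e * (exp (- (2 * \<delta>)) * exp (2 * \<delta>))"
    proof (intro mult_left_mono)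
      have "(1 - p) * (exp 1 - 1) \<le> \<delta> * 2"
        using p exp_le \<delta> by (intro mult_mono) auto
      then show "1 + (1 - p) * (exp 1 - 1) \<le> exp (2 * \<delta>)"
        using exp_ge_add_one_self[of "2 * \<delta>"] by linarith
    qed auto
    also have "\<dots> = ?V n f c" using late by (simp add: crossing_bound_def flip: exp_add)
    finally show ?thesis .
  qed
qed

text \<open>Adaptive sampling makes the crossings dependent, so their probabilities cannot simply be
  multiplied. Instead the product of the \<open>v\<close> is followed: each round alters at most one
  factor, and the remaining ones form a nonnegative constant.\<close>

lemma all_good_arms_cross:
  assumes act: "non_anticipating act" and range: "\<And>Y t. act Y t < k"
    and mu: "\<And>i. i < k \<Longrightarrow> 0 \<le> \<mu> i \<and> \<mu> i \<le> 1"
    and I: "finite I" "\<And>i. i \<in> I \<Longrightarrow> 1 - \<mu> i \<le> \<delta>"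
  shows "measure_pmf.expectation (reward_pmf k T \<mu>)
      (\<lambda>Y. of_bool (\<forall>i\<in>I. crossed (2 * \<delta>) act Y i T)) \<le> (4 / 5 :: real) ^ card I"
proof -
  let ?E = "measure_pmf.expectation (reward_pmf k T \<mu>)"
  define v where "v t Y i =
    crossing_bound \<delta> N (pulls act Y i t) (fails act Y i t) (crossed (2 * \<delta>) act Y i t)" for t Y i
  have v_nonneg: "0 \<le> v t Y i" for t Y i by (simp add: v_def crossing_bound_nonneg)
  have step: "?E (\<lambda>Y. \<Prod>i\<in>I. v (Suc t) Y i) \<le> ?E (\<lambda>Y. \<Prod>i\<in>I. v t Y i)" if "t < T" for t
  proof (rule expectation_step[OF mu that, where a = "\<lambda>Y. act Y t"])
    fix Y
    let ?j = "act Y t"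
    let ?U = "\<lambda>b. Y((?j, t) := b)"
    \<comment> \<open>For an arm that is not pulled, the inequality tested at \<open>Suc t\<close>
      was already tested at \<open>t\<close>, so its flag is unchanged.\<close>
    have other: "v (Suc t) (?U b) i = v t Y i" if "i \<noteq> ?j" for i b
    proof -
      have "real (fails act Y i t) \<le> 2 * \<delta> * real (pulls act Y i t)" if "\<not> crossed (2 * \<delta>) act Y i t"
        using that by (force simp: crossed_def not_less)
      then have "crossed (2 * \<delta>) act Y i t \<or>
          2 * \<delta> * real (pulls act Y i t) < real (fails act Y i t) \<longleftrightarrow> crossed (2 * \<delta>) act Y i t"
        by force
      then show ?thesis using that
        by (simp add: v_def crossed_Suc[OF act] crossed_upd[OF act] pulls_upd_Suc[OF act]
            fails_upd_Suc[OF act])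
    qed
    show "\<mu> ?j * (\<Prod>i\<in>I. v (Suc t) (?U True) i) + (1 - \<mu> ?j) * (\<Prod>i\<in>I. v (Suc t) (?U False) i)
        \<le> (\<Prod>i\<in>I. v t Y i)"
    proof (cases "?j \<in> I")
      case False
      then have "(\<Prod>i\<in>I. v (Suc t) (?U b) i) = (\<Prod>i\<in>I. v t Y i)" for b
        by (intro prod.cong refl other) auto
      then show ?thesis by (simp add: algebra_simps)
    next
      case True
      define P where "P = (\<Prod>i\<in>I - {?j}. v t Y i)"
      have P: "(\<Prod>i\<in>I. v (Suc t) (?U b) i) = v (Suc t) (?U b) ?j * P" for b
        unfolding P_def by (subst prod.remove[OF I(1) True]) (auto intro!: prod.cong simp: other)
      have "\<mu> ?j * v (Suc t) (?U True) ?j + (1 - \<mu> ?j) * v (Suc t) (?U False) ?j \<le> v t Y ?j"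
      proof -
        have "real (fails act Y ?j t) \<le> 2 * \<delta> * real (pulls act Y ?j t)"
          if "\<not> crossed (2 * \<delta>) act Y ?j t"
          using that by (force simp: crossed_def not_less)
        from crossing_bound_step[OF _ _ _ this, where p = "\<mu> ?j"] show ?thesis
          using mu[OF range, of Y t] I(2)[OF True]
          by (simp add: v_def crossed_Suc[OF act] crossed_upd[OF act] pulls_upd_Suc[OF act]
            fails_upd_Suc[OF act])
      qed
      then have "(\<mu> ?j * v (Suc t) (?U True) ?j + (1 - \<mu> ?j) * v (Suc t) (?U False) ?j) * P \<le> v t Y ?j * P"
        by (rule mult_right_mono) (auto simp: P_def intro!: prod_nonneg v_nonneg)
      then show ?thesis unfolding P using prod.remove[OF I(1) True, of "v t Y"]
        by (simp add: P_def algebra_simps)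
    qed
  qed (auto simp: range non_anticipatingD[OF act])
  have "?E (\<lambda>Y. \<Prod>i\<in>I. v n Y i) \<le> ?E (\<lambda>Y. \<Prod>i\<in>I. v 0 Y i)" if "n \<le> T" for n
    using that
  proof (induction n)
    case (Suc n)
    then show ?case using step[of n] by simp
  qed simp
  from this[of T] have "?E (\<lambda>Y. \<Prod>i\<in>I. v T Y i) \<le> ?E (\<lambda>Y. \<Prod>i\<in>I. v 0 Y i)" by simp
  also have "\<dots> \<le> ?E (\<lambda>Y. (4 / 5) ^ card I)"
  proof (rule integral_mono)
    show "(\<Prod>i\<in>I. v 0 Y i) \<le> (4 / 5) ^ card I" for Y
    proof -
      have "(\<Prod>i\<in>I. v 0 Y i) \<le> (\<Prod>i\<in>I. 4 / 5)"
        using crossing_bound_0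
        by (intro prod_mono) (auto simp: v_nonneg, auto simp: v_def pulls_def fails_def crossed_def)
      then show ?thesis by simp
    qed
  qed auto
  also have "\<dots> = (4 / 5) ^ card I" by simp
  finally have "?E (\<lambda>Y. \<Prod>i\<in>I. v T Y i) \<le> (4 / 5) ^ card I" .
  \<comment> \<open>Once all arms of \<open>I\<close> have crossed, every factor equals 1.\<close>
  moreover have "?E (\<lambda>Y. of_bool (\<forall>i\<in>I. crossed (2 * \<delta>) act Y i T)) \<le> ?E (\<lambda>Y. \<Prod>i\<in>I. v T Y i)"
  proof (rule integral_mono)
    show "of_bool (\<forall>i\<in>I. crossed (2 * \<delta>) act Y i T) \<le> (\<Prod>i\<in>I. v T Y i)" for Y
      by (auto simp: of_bool_def intro!: prod_nonneg v_nonneg) (simp add: v_def crossing_bound_def)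
  qed auto
  ultimately show ?thesis by linarith
qed

end

section \<open>The greedy policy\<close>

lemma length_greedy_hist [simp]: "length (greedy_hist S Y t) = t"
  by (induction t) (auto simp: Let_def)

lemma greedy_hist_nth: "s < t \<Longrightarrow> greedy_hist S Y t ! s = greedy_action S Y s"
  by (induction t) (auto simp: Let_def nth_append greedy_action_def less_Suc_eq)

lemma greedy_next_upd: "length h \<le> s \<Longrightarrow> greedy_next S (Y((i, s) := b)) h = greedy_next S Y h"
proof -
  assume h: "length h \<le> s"
  have "emp_mean (Y((i, s) := b)) h j = emp_mean Y h j" for j
    unfolding emp_mean_def Let_def using h by (intro arg_cong2[where f = "(/)"] sum.cong) auto
  then show ?thesis by (simp add: greedy_next_def)
qed

lemma greedy_hist_upd: "t \<le> s \<Longrightarrow> greedy_hist S (Y((i, s) := b)) t = greedy_hist S Y t"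
  by (induction t) (auto simp: Let_def greedy_next_upd)

lemma non_anticipating_greedy: "non_anticipating (greedy_action S)"
  by (auto simp: non_anticipating_def greedy_action_def greedy_hist_upd greedy_next_upd)

text \<open>Translates the history lists into the counters used by the potentials; for an arm
  without pulls both sides are 0 by the convention on division.\<close>

lemma emp_mean_greedy:
  "emp_mean Y (greedy_hist S Y t) i =
    (real (pulls (greedy_action S) Y i t) - real (fails (greedy_action S) Y i t)) /
     real (pulls (greedy_action S) Y i t)"
proof -
  let ?a = "greedy_action S"
  let ?ts = "{s. s < t \<and> ?a Y s = i}"
  have ts: "{s. s < length (greedy_hist S Y t) \<and> greedy_hist S Y t ! s = i} = ?ts"
    by (auto simp: greedy_hist_nth)
  have eq: "?ts = {..<t} \<inter> {s. ?a Y s = i}" by auto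
  have p: "real (pulls ?a Y i t) = real (card ?ts)"
    unfolding pulls_def eq by (simp add: of_bool_def sum.If_cases)
  have f: "real (fails ?a Y i t) = (\<Sum>s\<in>?ts. of_bool (\<not> Y (i, s)))"
    unfolding fails_def eq of_nat_sum
    by (subst sum.inter_restrict, simp, rule sum.cong) auto
  have "(\<Sum>s\<in>?ts. if Y (i, s) then 1 else 0) + (\<Sum>s\<in>?ts. of_bool (\<not> Y (i, s))) = (\<Sum>s\<in>?ts. 1 :: real)"
    unfolding sum.distrib[symmetric] by (intro sum.cong) auto
  then show ?thesis unfolding emp_mean_def Let_def ts p f by (simp add: algebra_simps)
qed

context
  fixes S :: "nat set" assumes S: "finite S" "S \<noteq> {}"
begin

lemma greedy_next_argmax:
  assumes "card S \<le> length h"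
  shows "greedy_next S Y h \<in> S \<and> (\<forall>j\<in>S. emp_mean Y h j \<le> emp_mean Y h (greedy_next S Y h))"
proof -
  obtain i where i: "i \<in> S" "emp_mean Y h i = Max (emp_mean Y h ` S)"
    using Max_in[of "emp_mean Y h ` S"] S by (metis empty_is_image finite_imageI imageE)
  then have "\<forall>j\<in>S. emp_mean Y h j \<le> emp_mean Y h i" using S by simp
  then have "(LEAST i. i \<in> S \<and> (\<forall>j\<in>S. emp_mean Y h j \<le> emp_mean Y h i)) \<in> S \<and>
    (\<forall>j\<in>S. emp_mean Y h j \<le> emp_mean Y h (LEAST i. i \<in> S \<and> (\<forall>j\<in>S. emp_mean Y h j \<le> emp_mean Y h i)))"
    using i(1) by (intro LeastI[where P = "\<lambda>i. i \<in> S \<and> (\<forall>j\<in>S. emp_mean Y h j \<le> emp_mean Y h i)"]) simp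
  then show ?thesis using assms by (simp add: greedy_next_def)
qed

lemma greedy_action_early: "t < card S \<Longrightarrow> greedy_action S Y t = sorted_list_of_set S ! t"
  by (simp add: greedy_action_def greedy_next_def)

lemma greedy_action_in: "greedy_action S Y t \<in> S"
proof (cases "t < card S")
  case True
  then show ?thesis
    using nth_mem[of t "sorted_list_of_set S"] S by (simp add: greedy_action_early)
qed (use greedy_next_argmax in \<open>auto simp: greedy_action_def\<close>)

lemma greedy_pulls_pos:
  assumes "i \<in> S" "card S \<le> t"
  shows "0 < pulls (greedy_action S) Y i t"
proof -
  obtain s where s: "s < card S" "sorted_list_of_set S ! s = i"
    using assms S by (metis in_set_conv_nth sorted_list_of_set.length_sorted_key_list_of_set
        sorted_list_of_set.set_sorted_key_list_of_set)
  then have s': "s < t" "greedy_action S Y s = i" using assms by (simp_all add: greedy_action_early)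
  then have "1 \<le> pulls (greedy_action S) Y i t"
    unfolding pulls_def using member_le_sum[of s "{..<t}" "\<lambda>s. of_bool (greedy_action S Y s = i) :: nat"]
    by simp
  then show ?thesis by simp
qed

text \<open>After the initial round every arm has been pulled, so the empirical mean is 1 minus the
  failure fraction, and the maximizer fails no more often in proportion than
  \<open>j\<close>.\<close>

lemma greedy_action_above_threshold:
  assumes t: "card S \<le> t" and j: "j \<in> S" "\<not> crossed \<theta> (greedy_action S) Y j t"
  defines "a \<equiv> greedy_action S Y t"
  shows "real (fails (greedy_action S) Y a t) \<le> \<theta> * real (pulls (greedy_action S) Y a t)"
proof -
  let ?p = "\<lambda>i. real (pulls (greedy_action S) Y i t)" and ?f = "\<lambda>i. real (fails (greedy_action S) Y i t)"
  have a: "a \<in> S" by (simp add: a_def greedy_action_in)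
  have pos: "0 < ?p a" "0 < ?p j" using greedy_pulls_pos[OF _ t] a j by auto
  have "emp_mean Y (greedy_hist S Y t) j \<le> emp_mean Y (greedy_hist S Y t) a"
    using greedy_next_argmax[of "greedy_hist S Y t" Y] t j by (simp add: a_def greedy_action_def)
  then have "(?p j - ?f j) / ?p j \<le> (?p a - ?f a) / ?p a" by (simp only: emp_mean_greedy)
  then have "?f a / ?p a \<le> ?f j / ?p j" using pos by (simp add: diff_divide_distrib)
  also have "?f j \<le> \<theta> * ?p j" using j(2) by (auto simp: crossed_def not_less)
  then have "?f j / ?p j \<le> \<theta>" using pos by (simp add: divide_le_eq)
  finally show ?thesis using pos by (simp add: divide_le_eq)
qed

text \<open>Regret is measured against reward 1 per round. Each arm contributes 20 = 1 + 19: its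
  initial pull and the bound on its later costly pulls. The product bounds the probability that all
  good arms cross.\<close>

lemma greedy_regret_bound:
  assumes Sk: "S \<subseteq> {..<k}" and mu: "\<And>i. i < k \<Longrightarrow> 0 \<le> \<mu> i \<and> \<mu> i \<le> 1"
    and \<delta>: "0 < \<delta>" "\<delta> \<le> 1 / 6"
  shows "real T - greedy_reward S k T \<mu> \<le>
    3 * \<delta> * real T + 20 * real (card S) + real T * (\<Prod>i\<in>S. 1 - indicator {1 - \<delta><..} (\<mu> i) / 5)"
proof -
  let ?a = "greedy_action S" and ?E = "measure_pmf.expectation (reward_pmf k T \<mu>)"
  have na: "non_anticipating ?a" by (rule non_anticipating_greedy)
  have range: "?a Y t < k" for Y t using greedy_action_in Sk by auto
  define I where "I = {i\<in>S. 1 - \<delta> < \<mu> i}"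
  define B where "B = {i\<in>S. 3 * \<delta> \<le> 1 - \<mu> i}"
  define bad where "bad Y i t = (1 - \<mu> i) * of_bool (?a Y t = i \<and>
      real (fails ?a Y i t) \<le> 2 * \<delta> * real (pulls ?a Y i t))" for Y i t
  define fail :: "(nat \<times> nat \<Rightarrow> bool) \<Rightarrow> real"
    where "fail Y = of_bool (\<forall>i\<in>I. crossed (2 * \<delta>) ?a Y i T)" for Y
  have fin: "finite I" "finite B" using S by (auto simp: I_def B_def)
  have mu_S: "0 \<le> \<mu> i \<and> \<mu> i \<le> 1" if "i \<in> S" for i using mu Sk that by auto
  have bad_nonneg: "0 \<le> bad Y i t" if "i \<in> S" for Y i t using mu_S[OF that] by (simp add: bad_def)

  have round: "1 - \<mu> (?a Y t) \<le> of_bool (t < card S) + fail Y + 3 * \<delta> + (\<Sum>i\<in>B. bad Y i t)"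
    if t: "t < T" for Y t
  proof -
    let ?j = "?a Y t"
    have j: "?j \<in> S" by (rule greedy_action_in)
    have sum_nonneg: "0 \<le> (\<Sum>i\<in>B. bad Y i t)" by (intro sum_nonneg bad_nonneg) (auto simp: B_def)
    have fail: "0 \<le> fail Y" by (simp add: fail_def)
    \<comment> \<open>Each round is charged to one source: the initial round, loss of all good arms,
      a gap below 3\<delta>, or a bad arm still above the threshold. If \<open>I\<close> is empty,
      \<open>fail\<close> is 1 and the second case applies.\<close>
    consider "t < card S" | "fail Y = 1" | "?j \<notin> B"
      | "card S \<le> t" "fail Y \<noteq> 1" "?j \<in> B" by linarith
    then show ?thesis
    proof cases
      case 4
      then obtain i where i: "i \<in> I" "\<not> crossed (2 * \<delta>) ?a Y i T" by (auto simp: fail_def)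
      then have "\<not> crossed (2 * \<delta>) ?a Y i t" using t by (auto simp: crossed_def)
      with greedy_action_above_threshold[OF 4(1), of i] i
      have "bad Y ?j t = 1 - \<mu> ?j" by (simp add: bad_def I_def)
      moreover have "bad Y ?j t \<le> (\<Sum>i\<in>B. bad Y i t)"
        using 4 fin by (intro member_le_sum bad_nonneg) (auto simp: B_def)
      ultimately show ?thesis using fail \<delta> by (simp add: add_nonneg_nonneg)
    qed (use mu_S[OF j] j sum_nonneg fail \<delta> in \<open>auto simp: B_def\<close>)
  qed
  have total: "real T - (\<Sum>t<T. \<mu> (?a Y t)) \<le>
      real (card S) + real T * fail Y + 3 * \<delta> * real T + (\<Sum>i\<in>B. \<Sum>t<T. bad Y i t)" for Y
  proof -
    have "real T - (\<Sum>t<T. \<mu> (?a Y t)) = (\<Sum>t<T. 1 - \<mu> (?a Y t))" by (simp add: sum_subtractf)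
    also have "\<dots> \<le> (\<Sum>t<T. of_bool (t < card S) + fail Y + 3 * \<delta> + (\<Sum>i\<in>B. bad Y i t))"
      by (intro sum_mono round) simp
    also have "\<dots> = (\<Sum>t<T. of_bool (t < card S)) + real T * fail Y + 3 * \<delta> * real T
        + (\<Sum>i\<in>B. \<Sum>t<T. bad Y i t)"
      by (simp add: sum.distrib sum.swap[of _ B])
    also have "(\<Sum>t<T. of_bool (t < card S)) \<le> real (card S)"
    proof -
      have "(\<Sum>t<T. of_bool (t < card S) :: real) = real (card ({..<T} \<inter> {t. t < card S}))"
        by (simp add: of_bool_def sum.If_cases)
      also have "card ({..<T} \<inter> {t. t < card S}) \<le> card {..<card S}" by (intro card_mono) auto
      finally show ?thesis by simp
    qed
    finally show ?thesis by simp
  qed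
  have bad_le: "?E (\<lambda>Y. \<Sum>t<T. bad Y i t) \<le> 19" if "i \<in> B" for i
    unfolding bad_def
    by (rule bad_arm_pulls[OF na range]) (use that mu_S \<delta> mu in \<open>auto simp: B_def\<close>)
  have fail_le: "?E fail \<le> (\<Prod>i\<in>S. 1 - indicator {1 - \<delta><..} (\<mu> i) / 5)"
  proof -
    obtain N0 where N0: "1 \<le> 2 * \<delta> * real N0"
      using reals_Archimedean3[of "2 * \<delta>"] \<delta> by (metis less_imp_le mult.commute zero_less_mult_iff zero_less_numeral)
    define N where "N = (LEAST N. 1 \<le> 2 * \<delta> * real N)"
    have N: "1 \<le> 2 * \<delta> * real N"
      using LeastI[of "\<lambda>N. 1 \<le> 2 * \<delta> * real N", OF N0] by (simp add: N_def)
    have N_less: "2 * \<delta> * real n < 1" if "n < N" for n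
      using not_less_Least[of n "\<lambda>N. 1 \<le> 2 * \<delta> * real N"] that by (auto simp: N_def)
    have "?E fail \<le> (4 / 5) ^ card I"
      unfolding fail_def using mu
      by (intro all_good_arms_cross[OF \<delta> N N_less na range]) (auto simp: I_def S)
    \<comment> \<open>Written as a product over all of \<open>S\<close>, the bound has one factor
      per arm and factorizes under the i.i.d. prior.\<close>
    also have "(4 / 5) ^ card I = (\<Prod>i\<in>I. 1 - indicator {1 - \<delta><..} (\<mu> i) / 5 :: real)"
      by (simp add: I_def)
    also have "\<dots> = (\<Prod>i\<in>S. 1 - indicator {1 - \<delta><..} (\<mu> i) / 5)"
      using S by (intro prod.mono_neutral_left) (auto simp: I_def)
    finally show ?thesis .
  qed
  have "real T - greedy_reward S k T \<mu> = ?E (\<lambda>Y. real T - (\<Sum>t<T. \<mu> (?a Y t)))"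
    by (simp add: greedy_reward_def)
  also have "\<dots> \<le> ?E (\<lambda>Y. real (card S) + real T * fail Y + 3 * \<delta> * real T + (\<Sum>i\<in>B. \<Sum>t<T. bad Y i t))"
    by (intro integral_mono total) auto
  also have "\<dots> = real (card S) + real T * ?E fail + 3 * \<delta> * real T + (\<Sum>i\<in>B. ?E (\<lambda>Y. \<Sum>t<T. bad Y i t))"
    by simp
  also have "\<dots> \<le> real (card S) + real T * (\<Prod>i\<in>S. 1 - indicator {1 - \<delta><..} (\<mu> i) / 5)
      + 3 * \<delta> * real T + (\<Sum>i\<in>B. 19)"
    by (intro add_mono mult_left_mono sum_mono bad_le fail_le) (use \<delta> in auto)
  also have "(\<Sum>i\<in>B. 19) \<le> 19 * real (card S)"
    using card_mono[of S B] S by (simp add: B_def)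
  finally show ?thesis by (simp add: algebra_simps)
qed

end

section \<open>Averaging over the prior\<close>

context
  fixes g :: "real \<Rightarrow> real" assumes dens: "is_prior_density g"
begin

lemma g_measurable [measurable]: "g \<in> borel_measurable borel"
  using dens by (simp add: is_prior_density_def)

lemma sets_prior [measurable_cong, simp]: "sets (prior g) = sets borel"
  by (simp add: prior_def)

lemma space_prior [simp]: "space (prior g) = UNIV"
  by (simp add: prior_def)

lemma prob_space_prior: "prob_space (prior g)"
  using dens by (intro prob_spaceI) (simp add: prior_def emeasure_density is_prior_density_def)

lemma AE_prior: "AE x in prior g. 0 \<le> x \<and> x \<le> 1"
proof -
  have "0 < g x \<longrightarrow> 0 \<le> x \<and> x \<le> 1" for x
    using dens by (force simp: is_prior_density_def)
  then show ?thesis unfolding prior_def by (subst AE_density) auto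
qed

lemma prob_space_means: "prob_space (means_measure g k)"
  unfolding means_measure_def by (intro prob_space_PiM prob_space_prior)

lemma AE_means: "AE \<mu> in means_measure g k. \<forall>i<k. 0 \<le> \<mu> i \<and> \<mu> i \<le> 1"
proof -
  have "AE \<mu> in means_measure g k. \<forall>i\<in>{..<k}. 0 \<le> \<mu> i \<and> \<mu> i \<le> 1"
    unfolding means_measure_def
    by (intro AE_finite_allI AE_PiM_component prob_space_prior AE_prior) auto
  then show ?thesis by auto
qed

lemma expectation_prod_means:
  fixes \<delta> :: real
  assumes "S \<subseteq> {..<k}"
  defines "h \<equiv> \<lambda>\<mu>. \<Prod>i\<in>S. 1 - indicator {1 - \<delta><..} (\<mu> i) / 5"
  shows "integrable (means_measure g k) h"
    and "(\<integral>\<mu>. h \<mu> \<partial>means_measure g k) = (1 - measure (prior g) {1 - \<delta><..} / 5) ^ card S"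
proof -
  interpret P: prob_space "prior g" by (rule prob_space_prior)
  interpret M: prob_space "means_measure g k" by (rule prob_space_means)
  interpret PP: product_sigma_finite "\<lambda>_. prior g" ..
  \<comment> \<open>Padding with factors 1 turns the product over \<open>S\<close> into one over all
    \<open>k\<close> coordinates, as Fubini requires.\<close>
  define f :: "nat \<Rightarrow> real \<Rightarrow> real"
    where "f i x = (if i \<in> S then 1 - indicator {1 - \<delta><..} x / 5 else 1)" for i x
  have h: "h = (\<lambda>\<mu>. \<Prod>i<k. f i (\<mu> i))"
    unfolding h_def f_def using assms by (intro ext prod.mono_neutral_cong_left) auto
  have [measurable]: "f i \<in> borel_measurable (prior g)" for i
    unfolding f_def by (cases "i \<in> S") auto
  have f01: "0 \<le> f i x \<and> f i x \<le> 1" for i x by (auto simp: f_def indicator_def)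
  have int: "integrable (prior g) (f i)" for i
    by (rule P.integrable_const_bound[of _ 1]) (use f01 in \<open>auto intro!: AE_I2\<close>)
  have "h \<in> borel_measurable (means_measure g k)"
    unfolding h means_measure_def by measurable
  moreover have "norm (h \<mu>) \<le> 1" for \<mu>
    unfolding h by (simp add: abs_prod) (use f01 in \<open>auto intro!: prod_le_1\<close>)
  ultimately show "integrable (means_measure g k) h"
    by (intro M.integrable_const_bound[of _ 1]) auto
  have "(\<integral>\<mu>. h \<mu> \<partial>means_measure g k) = (\<Prod>i<k. \<integral>x. f i x \<partial>prior g)"
    unfolding h means_measure_def by (rule PP.product_integral_prod) (auto simp: int)
  also have "\<dots> = (\<Prod>i\<in>S. \<integral>x. f i x \<partial>prior g)"
    using assms by (intro prod.mono_neutral_right) (use P.prob_space in \<open>auto simp: f_def\<close>)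
  also have "\<dots> = (\<Prod>i\<in>S. 1 - measure (prior g) {1 - \<delta><..} / 5)"
  proof (intro prod.cong refl)
    fix i assume "i \<in> S"
    then have "(\<integral>x. f i x \<partial>prior g) = (\<integral>x. 1 - indicator {1 - \<delta><..} x / 5 \<partial>prior g)"
      by (simp add: f_def)
    also have "\<dots> = 1 - measure (prior g) {1 - \<delta><..} / 5"
      using P.prob_space
      by (subst Bochner_Integration.integral_diff) (auto intro!: integrable_divide integrable_real_indicator
          simp: P.emeasure_eq_measure)
    finally show "(\<integral>x. f i x \<partial>prior g) = 1 - measure (prior g) {1 - \<delta><..} / 5" .
  qed
  finally show "(\<integral>\<mu>. h \<mu> \<partial>means_measure g k) = (1 - measure (prior g) {1 - \<delta><..} / 5) ^ card S"
    by simp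
qed

text \<open>Averaging over a family \<open>F\<close> of arm sets of size \<open>m\<close> treats
  both algorithms at once: a single set for Greedy, all \<open>m\<close>-subsets for
  SS-Greedy.\<close>

lemma bayes_regret_bound:
  fixes R :: "(nat \<Rightarrow> real) \<Rightarrow> real"
  assumes c0: "0 < c0" and reg: "one_regular g c0 C0"
    and T: "2 \<le> T" and m: "30 * ln (real T) / c0 \<le> real m"
    and F: "finite F" "F \<noteq> {}" "\<And>S. S \<in> F \<Longrightarrow> S \<subseteq> {..<k} \<and> card S = m"
    and R: "\<And>\<mu>. (\<And>i. i < k \<Longrightarrow> 0 \<le> \<mu> i \<and> \<mu> i \<le> 1) \<Longrightarrow>
      R \<mu> \<le> (\<Sum>S\<in>F. real T - greedy_reward S k T \<mu>) / card F"
  shows "(\<integral>\<mu>. R \<mu> \<partial>means_measure g k) \<le> 1 + 15 * real T * ln (real T) / (real m * c0) + 20 * real m"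
proof -
  interpret M: prob_space "means_measure g k" by (rule prob_space_means)
  let ?E = "integral\<^sup>L (means_measure g k)"
  \<comment> \<open>Chosen so that exp(-m c0 \<delta> / 5) = 1/T, which makes the failure term
    contribute at most 1; the lower bound on \<open>m\<close> says exactly \<delta> \<le>
    1/6.\<close>
  define \<delta> where "\<delta> = 5 * ln (real T) / (real m * c0)"
  define h where "h S \<mu> = (\<Prod>i\<in>S. 1 - indicator {1 - \<delta><..} (\<mu> i) / 5 :: real)"
    for S :: "nat set" and \<mu> :: "nat \<Rightarrow> real"
  have lnT: "0 < ln (real T)" using T by simp
  have mc: "30 * ln (real T) \<le> real m * c0" using m c0 by (simp add: pos_divide_le_eq)
  then have mc_pos: "0 < real m * c0" using lnT by linarith
  then have m0: "0 < m" using c0 by (simp add: zero_less_mult_iff)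
  have \<delta>: "0 < \<delta>" "\<delta> \<le> 1 / 6"
    using mc mc_pos lnT by (auto simp: \<delta>_def pos_divide_le_eq)
  have \<delta>T: "3 * \<delta> * real T = 15 * real T * ln (real T) / (real m * c0)" by (simp add: \<delta>_def)
  define U where "U \<mu> = 3 * \<delta> * real T + 20 * real m + real T * ((\<Sum>S\<in>F. h S \<mu>) / card F)" for \<mu>
  have cF: "0 < real (card F)" using F by (simp add: card_gt_0_iff)
  have int_h: "integrable (means_measure g k) (h S)" if "S \<in> F" for S
    unfolding h_def using F(3)[OF that] by (intro expectation_prod_means(1)) auto
  then have int_U: "integrable (means_measure g k) U"
    unfolding U_def by (intro Bochner_Integration.integrable_add Bochner_Integration.integrable_mult_right
      integrable_divide Bochner_Integration.integrable_sum M.integrable_const) auto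
  have Eh: "?E (h S) \<le> 1 / real T" if "S \<in> F" for S
  proof -
    have p: "c0 * \<delta> \<le> measure (prior g) {1 - \<delta><..}" using reg \<delta> by (auto simp: one_regular_def)
    have "?E (h S) = (1 - measure (prior g) {1 - \<delta><..} / 5) ^ m"
      unfolding h_def using F(3)[OF that] by (subst expectation_prod_means(2)) auto
    also have "\<dots> \<le> exp (- (c0 * \<delta> / 5)) ^ m"
    proof (rule power_mono)
      show "1 - measure (prior g) {1 - \<delta><..} / 5 \<le> exp (- (c0 * \<delta> / 5))"
        using p exp_ge_add_one_self[of "- (c0 * \<delta> / 5)"] by linarith
      show "0 \<le> 1 - measure (prior g) {1 - \<delta><..} / 5"
        using prob_space.prob_le_1[OF prob_space_prior, of "{1 - \<delta><..}"] by simp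
    qed
    also have "\<dots> = exp (- ln (real T))"
      using m0 c0 by (simp add: \<delta>_def flip: exp_of_nat_mult)
    also have "\<dots> = 1 / real T" using T by (simp add: exp_minus inverse_eq_divide)
    finally show ?thesis .
  qed
  have "?E U = 3 * \<delta> * real T + 20 * real m + real T * ((\<Sum>S\<in>F. ?E (h S)) / card F)"
  proof -
    have "integrable (means_measure g k) (\<lambda>\<mu>. \<Sum>S\<in>F. h S \<mu>)"
      by (intro Bochner_Integration.integrable_sum int_h)
    moreover have "?E (\<lambda>\<mu>. \<Sum>S\<in>F. h S \<mu>) = (\<Sum>S\<in>F. ?E (h S))"
      by (intro Bochner_Integration.integral_sum int_h)
    ultimately show ?thesis unfolding U_def by (simp add: M.prob_space)
  qed
  also have "\<dots> \<le> 3 * \<delta> * real T + 20 * real m + real T * ((\<Sum>S\<in>F. 1 / real T) / card F)"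
    by (intro add_left_mono mult_left_mono divide_right_mono sum_mono Eh) auto
  also have "\<dots> = 3 * \<delta> * real T + 20 * real m + 1" using cF T by simp
  finally have EU: "?E U \<le> 1 + 15 * real T * ln (real T) / (real m * c0) + 20 * real m"
    using \<delta>T by simp
  have RU: "AE \<mu> in means_measure g k. R \<mu> \<le> U \<mu>"
    using AE_means
  proof eventually_elim
    case (elim \<mu>)
    have "R \<mu> \<le> (\<Sum>S\<in>F. real T - greedy_reward S k T \<mu>) / card F" using elim by (intro R) auto
    also have "\<dots> \<le> (\<Sum>S\<in>F. 3 * \<delta> * real T + 20 * real m + real T * h S \<mu>) / card F"
    proof (intro divide_right_mono sum_mono)
      fix S assume "S \<in> F"
      then have "S \<subseteq> {..<k}" "card S = m" "S \<noteq> {}" "finite S"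
        using F(3)[of S] m0 by (auto intro: finite_subset)
      then show "real T - greedy_reward S k T \<mu> \<le> 3 * \<delta> * real T + 20 * real m + real T * h S \<mu>"
        using greedy_regret_bound[of S k \<mu> \<delta> T] elim \<delta> by (simp add: h_def)
    qed simp
    also have "\<dots> = U \<mu>" using cF
      by (simp add: U_def sum.distrib add_divide_distrib flip: sum_distrib_left)
    finally show ?case .
  qed
  show ?thesis
    \<comment> \<open>No measurability of \<open>R\<close> is assumed: a non-integrable \<open>R\<close> has integral 0.\<close>
  proof (cases "integrable (means_measure g k) R")
    case True
    have "?E R \<le> ?E U" by (rule integral_mono_AE[OF True int_U RU])
    then show ?thesis using EU by linarith
  next
    case False
    then have "?E R = 0" by (rule not_integrable_integral_eq)
    moreover have "0 \<le> 15 * real T * ln (real T) / (real m * c0)" using lnT mc_pos by simp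
    ultimately show ?thesis by simp
  qed
qed

end

section \<open>The regret bounds for Greedy and SS-Greedy\<close>

lemma Max_means_le_1:
  fixes k :: nat
  assumes "0 < k" "\<And>i. i < k \<Longrightarrow> \<mu> i \<le> 1"
  shows "Max (\<mu> ` {..<k}) \<le> (1 :: real)"
proof -
  have "Max (\<mu> ` {..<k}) \<in> \<mu> ` {..<k}" using assms(1) by (intro Max_in) auto
  then show ?thesis using assms(2) by auto
qed

theorem theorem4:
  fixes g :: "real \<Rightarrow> real" and c0 C0 :: real
  assumes dens: "is_prior_density g"
    and c0_pos: "0 < c0" and c0_C0: "c0 < C0"
    and reg: "one_regular g c0 C0"
  shows "(\<forall>T k::nat. 2 \<le> T \<longrightarrow> real k \<ge> 30 * ln (real T) / c0 \<longrightarrow>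
            BR_greedy g T k \<le> 1 + 15 * real T * ln (real T) / (real k * c0)
              + 3 * C0 * real k / ((1 - exp (-1)) / 2)
                * (5 + ln (real k * c0 / 5) - ln (ln (real T))))
      \<and> (\<forall>m :: nat \<Rightarrow> nat.
           (\<exists>c C. 0 < c \<and> (\<forall>\<^sub>F T in at_top. c * sqrt (real T) \<le> real (m T) \<and> real (m T) \<le> C * sqrt (real T)))
           \<longrightarrow> (\<exists>A (p::nat). \<forall>\<^sub>F T in at_top. \<forall>k. m T \<le> k \<longrightarrow>
                  BR_ss_greedy g (m T) T k \<le> A * sqrt (real T) * ln (real T) ^ p))"
proof (intro conjI allI impI)
  fix T k :: nat
  assume T: "2 \<le> T" and k: "30 * ln (real T) / c0 \<le> real k"
  have lnT: "0 < ln (real T)" using T by simp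
  have kc: "30 * ln (real T) \<le> real k * c0" using k c0_pos by (simp add: pos_divide_le_eq)
  then have "0 < real k * c0" using lnT by linarith
  then have k0: "0 < k" using c0_pos by (simp add: zero_less_mult_iff)
  have "BR_greedy g T k \<le> 1 + 15 * real T * ln (real T) / (real k * c0) + 20 * real k"
    unfolding BR_greedy_def
  proof (rule bayes_regret_bound[OF dens c0_pos reg T k, where F = "{{..<k}}"])
    fix \<mu> assume "\<And>i. i < k \<Longrightarrow> 0 \<le> \<mu> i \<and> \<mu> i \<le> (1 :: real)"
    then have "real T * Max (\<mu> ` {..<k}) \<le> real T * 1" using k0
      by (intro mult_left_mono Max_means_le_1) auto
    then show "regret_greedy k T \<mu> \<le> (\<Sum>S\<in>{{..<k}}. real T - greedy_reward S k T \<mu>) / card {{..<k}}"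
      by (simp add: regret_greedy_def)
  qed auto
  \<comment> \<open>Regularity at \<epsilon> = 1 forces C0 \<ge> 1, and k c0 / 5 \<ge> 6 ln T makes
    the last factor at least 5. As (1 - 1/e)/2 \<le> 1/2, the right-hand side is at least
    30k.\<close>
  also have "20 * real k \<le> 3 * C0 * real k / ((1 - exp (-1)) / 2)
      * (5 + ln (real k * c0 / 5) - ln (ln (real T)))"
  proof -
    have "measure (prior g) {0..} \<le> C0"
      using reg unfolding one_regular_def by (auto dest!: spec[of _ 1])
    moreover have "measure (prior g) {0..} = 1"
    proof -
      interpret P: prob_space "prior g" by (rule prob_space_prior[OF dens])
      have "{0..} \<in> sets (prior g)" using sets_prior[OF dens] by simp
      moreover have "AE x in prior g. x \<in> {0..}" using AE_prior[OF dens] by auto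
      ultimately show ?thesis using P.prob_eq_1 by simp
    qed
    ultimately have C0: "1 \<le> C0" by simp
    have "ln (ln (real T)) \<le> ln (real k * c0 / 5)" using kc lnT by simp
    then have L: "5 \<le> 5 + ln (real k * c0 / 5) - ln (ln (real T))" by simp
    have "6 * real k * ((1 - exp (-1)) / 2) \<le> 6 * real k * (1 / 2)"
      by (intro mult_left_mono) auto
    also have "\<dots> \<le> 3 * C0 * real k" using C0 by (simp add: mult_right_mono)
    finally have "6 * real k \<le> 3 * C0 * real k / ((1 - exp (-1)) / 2)"
      by (simp add: pos_le_divide_eq)
    then have "6 * real k * 5 \<le> 3 * C0 * real k / ((1 - exp (-1)) / 2)
      * (5 + ln (real k * c0 / 5) - ln (ln (real T)))"
      using L by (intro mult_mono) auto
    then show ?thesis by simp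
  qed
  finally show "BR_greedy g T k \<le> 1 + 15 * real T * ln (real T) / (real k * c0)
      + 3 * C0 * real k / ((1 - exp (-1)) / 2) * (5 + ln (real k * c0 / 5) - ln (ln (real T)))"
    by simp
next
  fix m :: "nat \<Rightarrow> nat"
  assume "\<exists>c C. 0 < c \<and> (\<forall>\<^sub>F T in at_top. c * sqrt (real T) \<le> real (m T) \<and> real (m T) \<le> C * sqrt (real T))"
  then obtain c C where c: "0 < c"
    and ev: "\<forall>\<^sub>F T in at_top. c * sqrt (real T) \<le> real (m T) \<and> real (m T) \<le> C * sqrt (real T)"
    by blast
  \<comment> \<open>One summand for each term of the general bound, all compared with sqrt(T) ln T;
    the absolute value is there because no sign of \<open>C\<close> is assumed.\<close>
  let ?A = "1 + 15 / (c * c0) + 20 * \<bar>C\<bar>"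
  \<comment> \<open>A square root eventually dominates the logarithm, so \<open>m T\<close>
    satisfies the size condition of the general bound.\<close>
  have "\<forall>\<^sub>F T in at_top. 30 * ln (real T) / c0 \<le> c * sqrt (real T)"
    using c c0_pos by real_asymp
  moreover have "\<forall>\<^sub>F T in at_top. 1 \<le> ln (real T)" by real_asymp
  ultimately have "\<forall>\<^sub>F T in at_top. \<forall>k. m T \<le> k \<longrightarrow>
      BR_ss_greedy g (m T) T k \<le> ?A * sqrt (real T) * ln (real T) ^ 1"
    using ev eventually_ge_at_top[of 2]
  proof eventually_elim
    case (elim T)
    then have ln1: "1 \<le> ln (real T)" and T: "2 \<le> T"
      and mT: "c * sqrt (real T) \<le> real (m T)" "real (m T) \<le> C * sqrt (real T)"
      and m: "30 * ln (real T) / c0 \<le> real (m T)" by auto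
    have s: "1 \<le> sqrt (real T)" using T by simp
    have m_pos: "0 < real (m T)" using mT(1) c s by (smt (verit) mult_pos_pos)
    show ?case
    proof (intro allI impI)
      fix k assume mk: "m T \<le> k"
      let ?F = "{S. S \<subseteq> {..<k} \<and> card S = m T}"
      have fin: "finite ?F" by (rule finite_subset[of _ "Pow {..<k}"]) auto
      have ne: "?F \<noteq> {}" using mk by (auto intro!: exI[of _ "{..<m T}"])
      have "BR_ss_greedy g (m T) T k \<le>
          1 + 15 * real T * ln (real T) / (real (m T) * c0) + 20 * real (m T)"
        unfolding BR_ss_greedy_def
      proof (rule bayes_regret_bound[OF dens c0_pos reg T m fin ne])
        fix \<mu> assume "\<And>i. i < k \<Longrightarrow> 0 \<le> \<mu> i \<and> \<mu> i \<le> (1 :: real)"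
        then have "real T * Max (\<mu> ` {..<k}) \<le> real T * 1" using m_pos mk
          by (intro mult_left_mono Max_means_le_1) auto
        moreover have "0 < real (card ?F)" using fin ne by (simp add: card_gt_0_iff del: Collect_empty_eq)
        ultimately show "regret_ss_greedy (m T) k T \<mu> \<le>
            (\<Sum>S\<in>?F. real T - greedy_reward S k T \<mu>) / card ?F"
          using fin ne
          by (simp add: regret_ss_greedy_def subsets_pmf_def integral_pmf_of_set sum_subtractf
              diff_divide_distrib del: Collect_empty_eq)
      qed auto
      also have "15 * real T * ln (real T) / (real (m T) * c0) \<le>
          15 * real T * ln (real T) / (c * sqrt (real T) * c0)"
        using mT(1) c c0_pos s ln1 m_pos by (intro divide_left_mono mult_right_mono) auto
      also have "\<dots> = 15 / (c * c0) * (real T / sqrt (real T) * ln (real T))"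
        by (simp add: mult_ac)
      also have "real T / sqrt (real T) = sqrt (real T)" by (rule real_div_sqrt) simp
      also have "20 * real (m T) \<le> 20 * \<bar>C\<bar> * (sqrt (real T) * ln (real T))"
      proof -
        have "C * sqrt (real T) * 1 \<le> \<bar>C\<bar> * sqrt (real T) * ln (real T)"
          using ln1 by (intro mult_mono) auto
        then show ?thesis using mT(2) by simp
      qed
      also have "1 \<le> sqrt (real T) * ln (real T)"
        using mult_mono[OF s ln1] s by simp
      finally show "BR_ss_greedy g (m T) T k \<le> ?A * sqrt (real T) * ln (real T) ^ 1"
        by (simp add: algebra_simps)
    qed
  qed
  then show "\<exists>A (p::nat). \<forall>\<^sub>F T in at_top. \<forall>k. m T \<le> k \<longrightarrow>
      BR_ss_greedy g (m T) T k \<le> A * sqrt (real T) * ln (real T) ^ p"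
    by blast
qed

end
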